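(* Let $D$ be an integral domain. Then $|\operatorname{CoSp}(D)|\leq 1$.
   Context: All rings are commutative with identity. For ideals $I,J$ of a ring $A$, $\operatorname{Ann}(I)=\{a\in A\mid aI=0\}$ and $(J:I)=\{a\in A\mid aI\subseteq J\}$. The coproduct of $I$ and $J$ is the ideal $[I:J]:=(J:\operatorname{Ann}(I))=\{a\in A\mid a\operatorname{Ann}(I)\subseteq J\}$. An ideal $C$ of $A$ is coprime if $C\neq 0$ and, for all ideals $I,J$ of $A$, $C\subseteq [I:J]$ implies $C\subseteq I$ or $C\subseteq J$. $\operatorname{CoSp}(A)$ is the set of coprime ideals of $A$. *)

theory Defs
  imports "HOL-Algebra.Ideal"
begin

definition annihilator :: "('a, 'b) ring_scheme \<Rightarrow> 'a set \<Rightarrow> 'a set" where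
  "annihilator A I = {a \<in> carrier A. \<forall>x\<in>I. a \<otimes>\<^bsub>A\<^esub> x = \<zero>\<^bsub>A\<^esub>}"

text \<open>\<open>ideal_quotient A J I\<close> is $(J : I)$.\<close>

definition ideal_quotient :: "('a, 'b) ring_scheme \<Rightarrow> 'a set \<Rightarrow> 'a set \<Rightarrow> 'a set" where
  "ideal_quotient A J I = {a \<in> carrier A. \<forall>x\<in>I. a \<otimes>\<^bsub>A\<^esub> x \<in> J}"

text \<open>\<open>ideal_coproduct A I J\<close> is $[I : J] = (J : \mathrm{Ann}(I))$; the arguments swap sides.\<close>

definition ideal_coproduct :: "('a, 'b) ring_scheme \<Rightarrow> 'a set \<Rightarrow> 'a set \<Rightarrow> 'a set" where
  "ideal_coproduct A I J = ideal_quotient A J (annihilator A I)"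

definition coprime_ideal :: "('a, 'b) ring_scheme \<Rightarrow> 'a set \<Rightarrow> bool" where
  "coprime_ideal A C \<longleftrightarrow>
     ideal C A \<and> C \<noteq> {\<zero>\<^bsub>A\<^esub>} \<and>
     (\<forall>I J. ideal I A \<longrightarrow> ideal J A \<longrightarrow> C \<subseteq> ideal_coproduct A I J \<longrightarrow> C \<subseteq> I \<or> C \<subseteq> J)"

definition CoSp :: "('a, 'b) ring_scheme \<Rightarrow> 'a set set" where
  "CoSp A = {C. coprime_ideal A C}"

end

theory Submission
  imports Defs
begin

text \<open>In a domain every nonzero ideal \<open>I\<close> has zero annihilator, so \<open>[I : 0]\<close> is the whole ring.
  Hence a coprime ideal, not being contained in \<open>0\<close>, is contained in every nonzero ideal: it is the
  least nonzero ideal.\<close>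

lemma (in ideal) neq_zero_ideal_iff: "I \<noteq> {\<zero>} \<longleftrightarrow> (\<exists>x\<in>I. x \<noteq> \<zero>)"
  using additive_subgroup.zero_closed[OF is_additive_subgroup] by blast

text \<open>A single nonzero \<open>x\<close> in \<open>I\<close> suffices: without zero divisors,
  \<open>a \<otimes> x = \<zero>\<close> already forces \<open>a = \<zero>\<close>.\<close>

lemma (in domain) annihilator_eq_zero:
  assumes "ideal I R" "I \<noteq> {\<zero>}"
  shows "annihilator R I = {\<zero>}"
proof -
  interpret I: ideal I R by fact
  obtain x where "x \<in> I" "x \<noteq> \<zero>"
    using assms(2) I.neq_zero_ideal_iff by blast
  then show ?thesis
    unfolding annihilator_def using I.Icarr by (auto simp: integral_iff)
qed

lemma (in domain) ideal_coproduct_zero_right: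
  assumes "ideal I R" "I \<noteq> {\<zero>}"
  shows "ideal_coproduct R I {\<zero>} = carrier R"
  unfolding ideal_coproduct_def ideal_quotient_def annihilator_eq_zero[OF assms] by auto

lemma (in domain) coprime_ideal_subset:
  assumes C: "coprime_ideal R C" and I: "ideal I R" "I \<noteq> {\<zero>}"
  shows "C \<subseteq> I"
proof -
  interpret C: ideal C R using C by (simp add: coprime_ideal_def)
  have "C \<subseteq> ideal_coproduct R I {\<zero>}"
    using C.Icarr ideal_coproduct_zero_right[OF I] by blast
  then have "C \<subseteq> I \<or> C \<subseteq> {\<zero>}"
    using C I(1) zeroideal by (simp add: coprime_ideal_def)
  moreover have "\<not> C \<subseteq> {\<zero>}"
    using C C.neq_zero_ideal_iff by (auto simp: coprime_ideal_def)
  ultimately show ?thesis by blast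
qed

text \<open>Since \<open>card\<close> is 0 on infinite sets, the bound expresses the intended claim
  only together with finiteness.\<close>

theorem corollary3:
  fixes D :: "('a, 'b) ring_scheme"
  assumes "domain D"
  shows "finite (CoSp D) \<and> card (CoSp D) \<le> 1"
proof -
  \<comment> \<open>A coprime ideal is itself a nonzero ideal, so \<open>C'\<close> can serve as the
    ideal containing \<open>C\<close>; exchanging the two then gives equality.\<close>
  have "C \<subseteq> C'" if "C \<in> CoSp D" "C' \<in> CoSp D" for C C'
    using domain.coprime_ideal_subset[OF assms, of C C'] that
    by (simp add: CoSp_def coprime_ideal_def)
  then have "C = C'" if "C \<in> CoSp D" "C' \<in> CoSp D" for C C'
    using that by blast
  then have "CoSp D = {} \<or> (\<exists>C. CoSp D = {C})"
    by blast
  then show ?thesis by auto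
qed

end
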